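(* Let $\alpha=2$, $c>0$, $y_0\in\mathbb{R}^2$, $0<\lambda<\infty$, and let $F:[0,\infty)\to[0,1]$ be measurable with $F(r)\sim r^{-\nu}$ as $r\to\infty$ for some $\nu\in(0,2]$. Let $\Phi$ be the Poisson point process on $\mathbb{R}^2$ with intensity function $x\mapsto\lambda F(\|x\|)$ and $\mathsf I(y_0)$ the interference it generates at $y_0$. Then the expected number of interferers is infinite, $$\mathbb{E}[|\Phi|]=2\pi\lambda\int_0^\infty rF(r)\,\mathrm dr=\infty,$$ but the expected interference is finite, $\mathbb{E}[\mathsf I(y_0)]<\infty$.
   Context: Setting: the points of $\Phi$ carry i.i.d. non-negative random marks $\mathsf g_{\mathsf x}$ (fading coefficients, arbitrary distribution), independent of $\Phi$, with $\mathbb{E}[\mathsf g_{\mathsf x}]=1$. The path loss function is $\ell(r)=(c+r^{\alpha})^{-1}$, and $\mathsf I(y_0)=\sum_{\mathsf x\in\Phi}\mathsf g_{\mathsf x}\,\ell(\|\mathsf x-y_0\|)$. $|\Phi|$ is the total number of points of $\Phi$. The notation $F(r)\sim r^{-\nu}$ as $r\to\infty$ means $0<\lim_{r\to\infty}r^\nu F(r)<\infty$. *)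

theory Defs
  imports "HOL-Probability.Probability"
begin

text \<open>
  A point process is given by a measurable enumeration: in the outcome \<open>\<omega>\<close> its points are
  \<open>X n \<omega>\<close> for \<open>n < K \<omega>\<close>, where \<open>K \<omega> = \<infinity>\<close> is allowed. Points are counted
  with multiplicity; for a Poisson process with diffuse intensity measure this makes no
  difference almost surely.
\<close>

definition point_process ::
    "'w measure \<Rightarrow> ('w \<Rightarrow> enat) \<Rightarrow> (nat \<Rightarrow> 'w \<Rightarrow> 'b::topological_space) \<Rightarrow> bool" where
  "point_process M K X \<longleftrightarrow>
     K \<in> measurable M (count_space UNIV) \<and> (\<forall>n. X n \<in> borel_measurable M)"

definition point_count ::
    "('w \<Rightarrow> enat) \<Rightarrow> (nat \<Rightarrow> 'w \<Rightarrow> 'b) \<Rightarrow> 'b set \<Rightarrow> 'w \<Rightarrow> ennreal" where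
  "point_count K X B \<omega> =
     emeasure (count_space UNIV) {n. enat n < K \<omega> \<and> X n \<omega> \<in> B}"

text \<open>
  The Poisson weights are written out because \<open>poisson_pmf\<close> is only meaningful for a
  positive rate, whereas a set \<open>B\<close> may have intensity \<open>0\<close> (then \<open>0 ^ 0 = 1\<close> gives the
  point mass at \<open>0\<close>). For a \<open>\<sigma>\<close>-finite intensity measure the sets of finite intensity
  determine the process; that sets of infinite intensity almost surely contain infinitely
  many points is a consequence.
\<close>

definition poisson_process ::
    "'w measure \<Rightarrow> 'b::topological_space measure \<Rightarrow> ('w \<Rightarrow> enat) \<Rightarrow> (nat \<Rightarrow> 'w \<Rightarrow> 'b) \<Rightarrow> bool" where
  "poisson_process M \<Lambda> K X \<longleftrightarrow>
     point_process M K X \<and>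
     (\<forall>B\<in>sets borel. emeasure \<Lambda> B < \<infinity> \<longrightarrow>
        (\<forall>k::nat. measure M {\<omega> \<in> space M. point_count K X B \<omega> = of_nat k} =
            measure \<Lambda> B ^ k / fact k * exp (- measure \<Lambda> B))) \<and>
     (\<forall>(I::nat set) B. finite I \<longrightarrow> (\<forall>i\<in>I. B i \<in> sets borel) \<longrightarrow> disjoint_family_on B I \<longrightarrow>
        prob_space.indep_vars M (\<lambda>_. borel) (\<lambda>i. point_count K X (B i)) I)"

text \<open>
  The \<open>n\<close>-th point carries the mark \<open>g n\<close>; marks with index \<open>n \<ge> K \<omega>\<close> are not used.
  Independence of the marks from the process is stated for the generated \<open>\<sigma>\<close>-algebras, as
  \<open>indep_var\<close> requires both random variables to have the same type.
\<close>

definition iid_fading_marks ::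
    "'w measure \<Rightarrow> ('w \<Rightarrow> enat) \<Rightarrow> (nat \<Rightarrow> 'w \<Rightarrow> 'b::topological_space) \<Rightarrow> (nat \<Rightarrow> 'w \<Rightarrow> real) \<Rightarrow> bool" where
  "iid_fading_marks M K X g \<longleftrightarrow>
     prob_space.indep_vars M (\<lambda>_. borel) g UNIV \<and>
     (\<forall>m n. distr M borel (g m) = distr M borel (g n)) \<and>
     (\<forall>n. AE \<omega> in M. 0 \<le> g n \<omega>) \<and>
     (\<forall>n. prob_space.expectation M (g n) = 1) \<and>
     prob_space.indep_set M
       (sets (vimage_algebra (space M) (\<lambda>\<omega>. (K \<omega>, \<lambda>n. X n \<omega>))
                (count_space UNIV \<Otimes>\<^sub>M (\<Pi>\<^sub>M n\<in>UNIV. borel))))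
       (sets (vimage_algebra (space M) (\<lambda>\<omega> n. g n \<omega>) (\<Pi>\<^sub>M n\<in>UNIV. borel)))"

definition path_loss :: "real \<Rightarrow> real \<Rightarrow> real \<Rightarrow> real" where
  "path_loss c \<alpha> r = 1 / (c + r powr \<alpha>)"

definition interference ::
    "(real \<Rightarrow> real) \<Rightarrow> ('w \<Rightarrow> enat) \<Rightarrow> (nat \<Rightarrow> 'w \<Rightarrow> 'b::real_normed_vector) \<Rightarrow> (nat \<Rightarrow> 'w \<Rightarrow> real)
      \<Rightarrow> 'b \<Rightarrow> 'w \<Rightarrow> ennreal" where
  "interference l K X g y \<omega> =
     (\<Sum>n. if enat n < K \<omega> then ennreal (g n \<omega> * l (norm (X n \<omega> - y))) else 0)"

definition power_law_decay :: "(real \<Rightarrow> real) \<Rightarrow> real \<Rightarrow> bool" where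
  "power_law_decay F \<nu> \<longleftrightarrow> (\<exists>L>0. ((\<lambda>r. r powr \<nu> * F r) \<longlongrightarrow> L) at_top)"

definition radial_intensity :: "real \<Rightarrow> (real \<Rightarrow> real) \<Rightarrow> 'b::euclidean_space measure" where
  "radial_intensity lam F = density lborel (\<lambda>x. ennreal (lam * F (norm x)))"

end

theory Submission
  imports Defs
begin

text \<open>
  The intensity measure of any set is the mean number of points in it, because a Poisson
  variable has its parameter as mean. Campbell's formula follows by monotone approximation, and as
  the marks are independent of the points and have mean 1, the mean interference is the integral of
  \<open>l (norm (x - y0))\<close> against the intensity measure. In polar coordinates the mean number of points
  is an integral that is bounded below by a multiple of \<open>\<integral> 1 / r dr\<close> since \<open>\<nu> \<le> 2\<close>. The path loss
  contributes another factor \<open>r\<^sup>-\<^sup>2\<close>, so that the mean interference is at most a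
  constant plus a multiple of \<open>\<integral> r powr (- 1 - \<nu>) dr\<close>, which converges since \<open>\<nu> > 0\<close>.
\<close>

section \<open>The mean of a Poisson variable\<close>

lemma poisson_weights_sums: "(\<lambda>k. m ^ k / fact k * exp (- m)) sums (1::real)"
proof -
  have "(\<lambda>k. m ^ k / fact k * exp (- m)) sums (exp m * exp (- m))"
    using exp_converges[of m] by (intro sums_mult2) (simp add: divide_inverse ac_simps)
  then show ?thesis
    by (simp add: exp_minus)
qed

text \<open>Since k / k! = 1 / (k - 1)!, the series is \<open>m\<close> times the series of the
  weights, shifted by one index. The term at 0 that the shift leaves out vanishes.\<close>

lemma poisson_mean_sums: "(\<lambda>k. real k * (m ^ k / fact k * exp (- m))) sums m"
proof -
  have "(\<lambda>k. m * (m ^ k / fact k * exp (- m))) sums (m * 1)"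
    by (intro sums_mult poisson_weights_sums)
  then have "(\<lambda>k. real (Suc k) * (m ^ Suc k / fact (Suc k) * exp (- m))) sums m"
    by (simp add: field_simps del: of_nat_Suc)
  then show ?thesis
    by (subst (asm) sums_Suc_iff) simp
qed

text \<open>A priori \<open>N\<close> may be infinite or not an integer. The weights sum to 1, so
  almost surely \<open>N\<close> is one of the naturals, and its integral is the weighted
  series.\<close>

lemma (in prob_space) nn_integral_poisson:
  fixes N :: "'a \<Rightarrow> ennreal"
  assumes [measurable]: "N \<in> borel_measurable M"
    and N: "\<And>k::nat. prob {\<omega> \<in> space M. N \<omega> = of_nat k} = m ^ k / fact k * exp (- m)"
    and m: "0 \<le> m"
  shows "(\<integral>\<^sup>+ \<omega>. N \<omega> \<partial>M) = ennreal m"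
proof -
  let ?A = "\<lambda>k::nat. {\<omega> \<in> space M. N \<omega> = of_nat k}"
  have disj: "disjoint_family ?A"
    by (auto simp: disjoint_family_on_def)
  have "(\<lambda>k. prob (?A k)) sums prob (\<Union>k. ?A k)"
    by (rule finite_measure_UNION) (use disj in auto)
  then have "prob (\<Union>k. ?A k) = 1"
    unfolding N using poisson_weights_sums sums_unique2 by blast
  then have "AE \<omega> in M. \<omega> \<in> (\<Union>k. ?A k)"
    by (rule AE_prob_1)
  \<comment> \<open>The level sets are disjoint, so exactly one term of the series survives.\<close>
  moreover have "N \<omega> = (\<Sum>k. of_nat k * indicator (?A k) \<omega>)" if \<omega>: "\<omega> \<in> (\<Union>k. ?A k)" for \<omega>
  proof -
    obtain j where j: "\<omega> \<in> ?A j"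
      using \<omega> by blast
    have ind: "indicator (?A k) \<omega> = (if k = j then 1 else 0 :: ennreal)" for k
      using j by (cases "k = j") (auto simp: indicator_def)
    have "(\<Sum>k. of_nat k * indicator (?A k) \<omega>) = (\<Sum>k\<in>{j}. of_nat k :: ennreal)"
      unfolding ind by (subst suminf_finite[of "{j}"]) auto
    also have "\<dots> = N \<omega>"
      using j by simp
    finally show ?thesis ..
  qed
  ultimately have "AE \<omega> in M. N \<omega> = (\<Sum>k. of_nat k * indicator (?A k) \<omega>)"
    by (rule eventually_mono)
  then have "(\<integral>\<^sup>+ \<omega>. N \<omega> \<partial>M) = (\<integral>\<^sup>+ \<omega>. (\<Sum>k. of_nat k * indicator (?A k) \<omega>) \<partial>M)"
    by (rule nn_integral_cong_AE)
  also have "\<dots> = (\<Sum>k. of_nat k * emeasure M (?A k))"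
    by (subst nn_integral_suminf) (auto simp: nn_integral_cmult)
  also have "\<dots> = (\<Sum>k. ennreal (real k * (m ^ k / fact k * exp (- m))))"
    unfolding emeasure_eq_measure N
    by (intro suminf_cong, subst ennreal_mult') (simp_all add: ennreal_of_nat_eq_real_of_nat)
  also have "\<dots> = ennreal m"
    using poisson_mean_sums[of m] m by (intro suminf_ennreal_eq) auto
  finally show ?thesis .
qed

section \<open>Mean counts and Campbell's formula\<close>

text \<open>A cardinality is a sum of indicators over the indices. This form gives measurability of
  the count and makes it the indicator case of Campbell's formula.\<close>

lemma point_count_eq_suminf:
  "point_count K X B \<omega> = (\<Sum>n. if enat n < K \<omega> then indicator B (X n \<omega>) else 0)"
proof -
  have "point_count K X B \<omega> =
      (\<integral>\<^sup>+ n. indicator {n. enat n < K \<omega> \<and> X n \<omega> \<in> B} n \<partial>count_space UNIV)"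
    by (simp add: point_count_def)
  also have "\<dots> = (\<Sum>n. if enat n < K \<omega> then indicator B (X n \<omega>) else 0)"
    unfolding nn_integral_count_space_nat
    by (intro suminf_cong) (auto simp: indicator_def)
  finally show ?thesis .
qed

lemma point_process_measurable_points:
  fixes X :: "nat \<Rightarrow> 'w \<Rightarrow> 'b::topological_space"
  assumes "point_process M K X"
  shows "Measurable.pred M (\<lambda>\<omega>. enat n < K \<omega>)" and "X n \<in> borel_measurable M"
proof -
  have K: "K \<in> measurable M (count_space UNIV)"
    using assms by (simp add: point_process_def)
  have "(\<lambda>k. enat n < k) \<in> measurable (count_space UNIV) (count_space UNIV)"
    by simp
  from measurable_compose[OF K this] show "Measurable.pred M (\<lambda>\<omega>. enat n < K \<omega>)" .
  show "X n \<in> borel_measurable M"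
    using assms by (simp add: point_process_def)
qed

lemma borel_measurable_point_count:
  fixes X :: "nat \<Rightarrow> 'w \<Rightarrow> 'b::topological_space"
  assumes "point_process M K X" and [measurable]: "B \<in> sets borel"
  shows "point_count K X B \<in> borel_measurable M"
proof -
  note [measurable] = point_process_measurable_points[OF assms(1)]
  show ?thesis
    unfolding point_count_eq_suminf[abs_def] by measurable
qed

text \<open>The Poisson law is prescribed only for sets of finite intensity. An arbitrary
  \<open>B\<close> is cut along a countable partition into pieces of finite intensity, and both
  sides are countably additive. Sets of infinite intensity are thus covered too.\<close>

lemma nn_integral_point_count:
  fixes X :: "nat \<Rightarrow> 'w \<Rightarrow> 'b::topological_space"
  assumes "prob_space M" and P: "poisson_process M \<Lambda> K X"
    and "sigma_finite_measure \<Lambda>" and sets: "sets \<Lambda> = sets borel" and B: "B \<in> sets borel"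
  shows "(\<integral>\<^sup>+ \<omega>. point_count K X B \<omega> \<partial>M) = emeasure \<Lambda> B"
proof -
  interpret prob_space M by fact
  interpret L: sigma_finite_measure \<Lambda> by fact
  have pp: "point_process M K X"
    using P by (simp add: poisson_process_def)
  have fin: "(\<integral>\<^sup>+ \<omega>. point_count K X C \<omega> \<partial>M) = emeasure \<Lambda> C"
    if C: "C \<in> sets borel" and "emeasure \<Lambda> C \<noteq> \<infinity>" for C
  proof -
    have "(\<integral>\<^sup>+ \<omega>. point_count K X C \<omega> \<partial>M) = ennreal (measure \<Lambda> C)"
    proof (rule nn_integral_poisson)
      show "point_count K X C \<in> borel_measurable M"
        by (rule borel_measurable_point_count[OF pp C])
      show "prob {\<omega> \<in> space M. point_count K X C \<omega> = of_nat k} =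
          measure \<Lambda> C ^ k / fact k * exp (- measure \<Lambda> C)" for k
        using P that by (auto simp: poisson_process_def less_top)
    qed simp
    then show ?thesis
      using that by (simp add: emeasure_eq_ennreal_measure)
  qed
  obtain A :: "nat \<Rightarrow> 'b set" where A: "range A \<subseteq> sets \<Lambda>" "(\<Union>i. A i) = space \<Lambda>"
      "\<And>i. emeasure \<Lambda> (A i) \<noteq> \<infinity>" "disjoint_family A"
    using L.sigma_finite_disjoint by blast
  define C where "C i = B \<inter> A i" for i
  have C: "C i \<in> sets borel" for i
    using A(1) B sets by (auto simp: C_def)
  have C_fin: "emeasure \<Lambda> (C i) \<noteq> \<infinity>" for i
  proof -
    have "emeasure \<Lambda> (C i) \<le> emeasure \<Lambda> (A i)"
      using A(1) by (intro emeasure_mono) (auto simp: C_def)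
    then show ?thesis
      using A(3)[of i] by (auto simp: top_unique)
  qed
  have disj: "disjoint_family C"
    using A(4) by (auto simp: C_def disjoint_family_on_def)
  have B_eq: "B = (\<Union>i. C i)"
    using A(2) sets_eq_imp_space_eq[OF sets] by (auto simp: C_def)
  have "point_count K X B \<omega> = (\<Sum>i. point_count K X (C i) \<omega>)" for \<omega>
  proof -
    have "{n. enat n < K \<omega> \<and> X n \<omega> \<in> B} = (\<Union>i. {n. enat n < K \<omega> \<and> X n \<omega> \<in> C i})"
      by (auto simp: B_eq)
    moreover have "disjoint_family (\<lambda>i. {n. enat n < K \<omega> \<and> X n \<omega> \<in> C i})"
      using disj by (auto simp: disjoint_family_on_def)
    ultimately show ?thesis
      unfolding point_count_def by (simp add: suminf_emeasure)
  qed
  then have "(\<integral>\<^sup>+ \<omega>. point_count K X B \<omega> \<partial>M) = (\<Sum>i. \<integral>\<^sup>+ \<omega>. point_count K X (C i) \<omega> \<partial>M)"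
    by (simp add: nn_integral_suminf borel_measurable_point_count[OF pp C])
  also have "\<dots> = (\<Sum>i. emeasure \<Lambda> (C i))"
    using fin[OF C C_fin] by simp
  also have "\<dots> = emeasure \<Lambda> B"
    unfolding B_eq using disj C sets by (intro suminf_emeasure) auto
  finally show ?thesis .
qed

text \<open>Both sides are linear and continuous along increasing sequences, so it suffices to know
  them on indicators, where the mean count applies. The left side is kept as a sum of integrals
  because the marks are later attached index by index.\<close>

lemma campbell_formula:
  fixes X :: "nat \<Rightarrow> 'w \<Rightarrow> 'b::topological_space"
  assumes "prob_space M" and P: "poisson_process M \<Lambda> K X"
    and "sigma_finite_measure \<Lambda>" and sets: "sets \<Lambda> = sets borel"
    and f: "f \<in> borel_measurable borel"
  shows "(\<Sum>n. \<integral>\<^sup>+ \<omega>. (if enat n < K \<omega> then f (X n \<omega>) else 0) \<partial>M) = (\<integral>\<^sup>+ x. f x \<partial>\<Lambda>)"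
proof -
  have pp: "point_process M K X"
    using P by (simp add: poisson_process_def)
  note [measurable] = point_process_measurable_points[OF pp]
  note [measurable_cong] = sets
  let ?S = "\<lambda>f \<omega>. \<Sum>n. if enat n < K \<omega> then f (X n \<omega>) else (0::ennreal)"
  have meas[measurable]: "?S f \<in> borel_measurable M" if [measurable]: "f \<in> borel_measurable borel" for f
    by measurable
  have "(\<integral>\<^sup>+ \<omega>. ?S f \<omega> \<partial>M) = (\<integral>\<^sup>+ x. f x \<partial>\<Lambda>)"
    using f
  proof (induction f rule: borel_measurable_induct)
    case (cong f g)
    \<comment> \<open>The space of \<open>borel\<close> is the whole type, so agreement on it is
      equality of functions.\<close>
    have "f = g"
      using cong(3) by (intro ext) simp
    show ?case
      unfolding \<open>f = g\<close> by (rule cong(4))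
  next
    case (set A)
    then show ?case
      using nn_integral_point_count[OF assms(1-4), of A] sets
      by (simp add: point_count_eq_suminf)
  next
    case (mult u c)
    note [measurable] = mult(2)
    have "?S (\<lambda>x. c * u x) \<omega> = c * ?S u \<omega>" for \<omega>
      unfolding ennreal_suminf_cmult[symmetric] by (intro suminf_cong) simp
    then show ?case
      using mult by (simp add: nn_integral_cmult)
  next
    case (add u v)
    note [measurable] = add(1,4)
    have "?S (\<lambda>x. v x + u x) \<omega> = ?S v \<omega> + ?S u \<omega>" for \<omega>
      by (subst suminf_add) (auto intro!: suminf_cong)
    then show ?case
      using add by (simp add: nn_integral_add)
  next
    case (seq U)
    note [measurable] = seq(1)
    have inc: "incseq (\<lambda>i. ?S (U i) \<omega>)" for \<omega>
      using \<open>incseq U\<close> by (intro monoI suminf_le) (auto simp: mono_def le_fun_def)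
    \<comment> \<open>Monotone convergence is used twice: here for the sum over indices, then for
      the integral over outcomes.\<close>
    have "?S (SUP i. U i) \<omega> = (SUP i. ?S (U i) \<omega>)" for \<omega>
    proof -
      have "(SUP i. ?S (U i) \<omega>) = (\<Sum>n. SUP i. if enat n < K \<omega> then U i (X n \<omega>) else 0)"
        using \<open>incseq U\<close> by (intro ennreal_suminf_SUP_eq[symmetric]) (auto simp: mono_def le_fun_def)
      also have "\<dots> = ?S (SUP i. U i) \<omega>"
        by (intro suminf_cong) (simp add: image_comp)
      finally show ?thesis ..
    qed
    then have "(\<integral>\<^sup>+ \<omega>. ?S (SUP i. U i) \<omega> \<partial>M) = (SUP i. \<integral>\<^sup>+ \<omega>. ?S (U i) \<omega> \<partial>M)"
      using inc by (simp add: nn_integral_monotone_convergence_SUP mono_def le_fun_def)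
    also have "\<dots> = (SUP i. \<integral>\<^sup>+ x. U i x \<partial>\<Lambda>)"
      using seq.IH by simp
    also have "\<dots> = (\<integral>\<^sup>+ x. (SUP i. U i) x \<partial>\<Lambda>)"
      using \<open>incseq U\<close> by (simp add: nn_integral_monotone_convergence_SUP image_comp)
    finally show ?case .
  qed
  moreover have "(\<integral>\<^sup>+ \<omega>. ?S f \<omega> \<partial>M) =
      (\<Sum>n. \<integral>\<^sup>+ \<omega>. (if enat n < K \<omega> then f (X n \<omega>) else 0) \<partial>M)"
  proof -
    note [measurable] = f
    show ?thesis
      by (intro nn_integral_suminf) measurable
  qed
  ultimately show ?thesis
    by simp
qed

section \<open>Independent marks and the mean interference\<close>

text \<open>The two-variable instance of the product formula for independent families. In
  \<open>ennreal\<close> it holds without integrability, so infinite means need no separate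
  treatment.\<close>

lemma (in prob_space) nn_integral_mult_indep_var:
  fixes U V :: "'a \<Rightarrow> ennreal"
  assumes "indep_var borel U borel V"
  shows "(\<integral>\<^sup>+ \<omega>. U \<omega> * V \<omega> \<partial>M) = (\<integral>\<^sup>+ \<omega>. U \<omega> \<partial>M) * (\<integral>\<^sup>+ \<omega>. V \<omega> \<partial>M)"
proof -
  have eq: "case_bool borel borel = (\<lambda>_. borel :: ennreal measure)"
    by (auto split: bool.split)
  have "indep_vars (\<lambda>_. borel) (case_bool U V) UNIV"
    using assms by (simp add: indep_var_def eq)
  from indep_vars_nn_integral[OF _ this] show ?thesis
    by (simp add: UNIV_bool mult.commute)
qed

text \<open>The Bochner integral of a non-integrable function is 0, so mean 1 forces integrability.
  Almost sure nonnegativity then identifies the two integrals.\<close>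

lemma nn_integral_fading_mark:
  assumes "prob_space M" and "iid_fading_marks M K X g"
  shows "(\<integral>\<^sup>+ \<omega>. ennreal (g n \<omega>) \<partial>M) = 1"
proof -
  interpret prob_space M by fact
  have g: "expectation (g n) = 1" "AE \<omega> in M. 0 \<le> g n \<omega>"
    using assms(2) by (auto simp: iid_fading_marks_def)
  have "integrable M (g n)"
    using g(1) not_integrable_integral_eq by fastforce
  then show ?thesis
    using g by (simp add: nn_integral_eq_integral)
qed

text \<open>Independence is assumed for the \<sigma>-algebras generated by all points and by all
  marks. Each of the two variables factors measurably through one of these families, so it generates
  a smaller \<sigma>-algebra.\<close>

lemma indep_var_fading_mark:
  fixes X :: "nat \<Rightarrow> 'w \<Rightarrow> 'b::topological_space"
  assumes "prob_space M" and pp: "point_process M K X" and marks: "iid_fading_marks M K X g"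
    and h: "h \<in> borel_measurable borel"
  shows "prob_space.indep_var M borel (\<lambda>\<omega>. ennreal (g n \<omega>))
           borel (\<lambda>\<omega>. if enat n < K \<omega> then h (X n \<omega>) else (0::ennreal))"
proof -
  interpret prob_space M by fact
  let ?U = "\<lambda>\<omega>. if enat n < K \<omega> then h (X n \<omega>) else (0::ennreal)"
  let ?V = "\<lambda>\<omega>. ennreal (g n \<omega>)"
  let ?P = "(count_space UNIV \<Otimes>\<^sub>M (\<Pi>\<^sub>M n\<in>UNIV. borel)) :: (enat \<times> (nat \<Rightarrow> 'b)) measure"
  let ?G = "(\<Pi>\<^sub>M n\<in>UNIV. borel) :: (nat \<Rightarrow> real) measure"
  let ?VP = "vimage_algebra (space M) (\<lambda>\<omega>. (K \<omega>, \<lambda>n. X n \<omega>)) ?P"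
  let ?VG = "vimage_algebra (space M) (\<lambda>\<omega> n. g n \<omega>) ?G"
  note [measurable] = h
  have indep: "indep_set (sets ?VP) (sets ?VG)" and g: "indep_vars (\<lambda>_. borel) g UNIV"
    using marks by (auto simp: iid_fading_marks_def)
  have [measurable]: "Measurable.pred M (\<lambda>\<omega>. enat n < K \<omega>)" "X n \<in> borel_measurable M"
      "g n \<in> borel_measurable M"
    using point_process_measurable_points[OF pp] g by (auto simp: indep_vars_def)
  \<comment> \<open>This is the map through which \<open>?U\<close> factors: \<open>p\<close> stands
    for the pair of the number of points and their sequence.\<close>
  have P: "(\<lambda>p. if enat n < fst p then h (snd p n) else 0) \<in> borel_measurable ?P"
    by measurable
  have "?U \<in> borel_measurable ?VP"
    using measurable_compose[OF measurable_vimage_algebra1 P, of "\<lambda>\<omega>. (K \<omega>, \<lambda>n. X n \<omega>)" "space M"]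
    by (simp add: space_pair_measure space_PiM cong: if_cong)
  then have U: "{?U -` A \<inter> space M | A. A \<in> sets borel} \<subseteq> sets ?VP"
    by (auto dest: measurable_sets)
  have G: "(\<lambda>x. ennreal (x n)) \<in> borel_measurable ?G"
    by measurable
  have "?V \<in> borel_measurable ?VG"
    using measurable_compose[OF measurable_vimage_algebra1 G, of "\<lambda>\<omega> n. g n \<omega>" "space M"]
    by (simp add: space_PiM)
  then have V: "{?V -` A \<inter> space M | A. A \<in> sets borel} \<subseteq> sets ?VG"
    by (auto dest: measurable_sets)
  have "indep_set (sigma_sets (space M) {?V -` A \<inter> space M | A. A \<in> sets borel})
      (sigma_sets (space M) {?U -` A \<inter> space M | A. A \<in> sets borel})"
    unfolding indep_sets2_eq
  proof (intro conjI ballI)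
    have sub: "sigma_sets (space M) {?U -` A \<inter> space M | A. A \<in> sets borel} \<subseteq> sets ?VP"
        "sigma_sets (space M) {?V -` A \<inter> space M | A. A \<in> sets borel} \<subseteq> sets ?VG"
      using sets.sigma_sets_subset[OF U] sets.sigma_sets_subset[OF V] by simp_all
    then show "sigma_sets (space M) {?V -` A \<inter> space M | A. A \<in> sets borel} \<subseteq> events"
        "sigma_sets (space M) {?U -` A \<inter> space M | A. A \<in> sets borel} \<subseteq> events"
      using indep_setD_ev1[OF indep] indep_setD_ev2[OF indep] by blast+
    fix a b
    assume "a \<in> sigma_sets (space M) {?V -` A \<inter> space M | A. A \<in> sets borel}"
      and "b \<in> sigma_sets (space M) {?U -` A \<inter> space M | A. A \<in> sets borel}"
    with sub have "b \<in> sets ?VP" "a \<in> sets ?VG"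
      by blast+
    \<comment> \<open>The assumption lists points before marks, the goal marks before points; hence
      the commutations.\<close>
    from indep_setD[OF indep this] show "prob (a \<inter> b) = prob a * prob b"
      by (simp add: Int_commute mult.commute)
  qed
  then show ?thesis
    unfolding indep_var_eq by simp
qed

text \<open>Each summand is a mark times a function of the points. Independence splits its mean, the
  mark contributes the factor 1, and Campbell's formula evaluates what remains.\<close>

lemma nn_integral_interference:
  fixes X :: "nat \<Rightarrow> 'w \<Rightarrow> 'b::real_normed_vector"
  assumes "prob_space M" and P: "poisson_process M \<Lambda> K X"
    and "sigma_finite_measure \<Lambda>" and "sets \<Lambda> = sets borel"
    and marks: "iid_fading_marks M K X g"
    and [measurable]: "l \<in> borel_measurable borel" and l: "\<And>r. 0 \<le> r \<Longrightarrow> 0 \<le> l r"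
  shows "(\<integral>\<^sup>+ \<omega>. interference l K X g y \<omega> \<partial>M) = (\<integral>\<^sup>+ x. ennreal (l (norm (x - y))) \<partial>\<Lambda>)"
proof -
  interpret prob_space M by fact
  have pp: "point_process M K X"
    using P by (simp add: poisson_process_def)
  have [measurable]: "g n \<in> borel_measurable M" for n
    using marks by (auto simp: iid_fading_marks_def indep_vars_def)
  let ?h = "\<lambda>x. ennreal (l (norm (x - y)))"
  let ?U = "\<lambda>n \<omega>. if enat n < K \<omega> then ?h (X n \<omega>) else 0"
  have "continuous_on UNIV (\<lambda>x. norm (x - y))"
    by (intro continuous_intros)
  then have "(\<lambda>x. norm (x - y)) \<in> borel_measurable borel"
    by (rule borel_measurable_continuous_onI)
  then have h[measurable]: "?h \<in> borel_measurable borel"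
    by measurable
  note [measurable] = point_process_measurable_points[OF pp]
  \<comment> \<open>\<open>ennreal_mult''\<close> asks for a nonnegative path loss factor only, so
    this holds at every outcome: where a mark is negative, both sides truncate to 0.\<close>
  have "interference l K X g y \<omega> = (\<Sum>n. ennreal (g n \<omega>) * ?U n \<omega>)" for \<omega>
    unfolding interference_def using l by (intro suminf_cong) (auto simp: ennreal_mult'')
  then have "(\<integral>\<^sup>+ \<omega>. interference l K X g y \<omega> \<partial>M) =
      (\<Sum>n. \<integral>\<^sup>+ \<omega>. ennreal (g n \<omega>) * ?U n \<omega> \<partial>M)"
    by (simp add: nn_integral_suminf)
  also have "\<dots> = (\<Sum>n. \<integral>\<^sup>+ \<omega>. ?U n \<omega> \<partial>M)"
    by (subst nn_integral_mult_indep_var[OF indep_var_fading_mark[OF assms(1) pp marks h]])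
      (simp add: nn_integral_fading_mark[OF assms(1) marks])
  also have "\<dots> = (\<integral>\<^sup>+ x. ?h x \<partial>\<Lambda>)"
    by (rule campbell_formula) fact+
  finally show ?thesis .
qed

section \<open>Polar coordinates and the radial intensity measure\<close>

text \<open>The half-lines \<open>{..r}\<close> generate the Borel sets, and their preimages under
  \<open>norm\<close> are the balls \<open>cball 0 r\<close>. The density is the derivative in
  \<open>r\<close> of the volume of such a ball.\<close>

lemma distr_norm_lborel:
  "distr (lborel :: 'a::euclidean_space measure) borel norm =
     density lborel (\<lambda>r. ennreal (DIM('a) * unit_ball_vol DIM('a) * r ^ (DIM('a) - 1)) * indicator {0..} r)"
  (is "?M = ?N")
proof (rule measure_eqI_generator_eq)
  let ?E = "range (atMost :: real \<Rightarrow> real set)"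
  let ?d = "DIM('a)"
  show "Int_stable ?E"
    by (auto simp: Int_stable_def)
  show "?E \<subseteq> Pow UNIV" "range (\<lambda>i::nat. {..real i}) \<subseteq> ?E"
    by auto
  show "sets ?M = sigma_sets UNIV ?E" "sets ?N = sigma_sets UNIV ?E"
    by (simp_all add: borel_eq_atMost)
  show "(\<Union>i::nat. {..real i}) = UNIV"
    using real_arch_simple by auto
  have M: "emeasure ?M {..r} = emeasure lborel (cball (0::'a) r)" for r
    by (subst emeasure_distr) (auto intro!: arg_cong[of _ _ "emeasure lborel"])
  show "emeasure ?M {..real i} \<noteq> \<infinity>" for i :: nat
    unfolding M by (simp add: emeasure_cball)
  show "emeasure ?M A = emeasure ?N A" if "A \<in> ?E" for A
  proof -
    obtain r where A: "A = {..r}"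
      using \<open>A \<in> ?E\<close> by blast
    have N: "emeasure ?N A =
        (\<integral>\<^sup>+ x. ennreal (?d * unit_ball_vol ?d * x ^ (?d - 1)) * indicator {0..r} x \<partial>lborel)"
      unfolding A by (subst emeasure_density) (auto intro!: nn_integral_cong simp: indicator_def)
    show ?thesis
    proof (cases "0 \<le> r")
      case True
      have "((\<lambda>x. unit_ball_vol ?d * x ^ ?d) has_real_derivative
          ?d * unit_ball_vol ?d * x ^ (?d - 1)) (at x)" for x
        by (auto intro!: derivative_eq_intros)
      then have "emeasure ?N A = ennreal (unit_ball_vol ?d * r ^ ?d - unit_ball_vol ?d * 0 ^ ?d)"
        unfolding N using True
        by (intro nn_integral_FTC_Icc) (auto intro: has_field_derivative_at_within)
      then show ?thesis
        using True by (simp add: A M emeasure_cball)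
    next
      case False
      then show ?thesis
        unfolding N by (simp add: A M)
    qed
  qed
qed

lemma nn_integral_norm_lborel:
  assumes [measurable]: "f \<in> borel_measurable borel"
  shows "(\<integral>\<^sup>+ x. f (norm x) \<partial>(lborel :: 'a::euclidean_space measure)) =
    (\<integral>\<^sup>+ r\<in>{0..}. ennreal (DIM('a) * unit_ball_vol DIM('a) * r ^ (DIM('a) - 1)) * f r \<partial>lborel)"
proof -
  have "(\<integral>\<^sup>+ x. f (norm x) \<partial>(lborel :: 'a measure)) = (\<integral>\<^sup>+ r. f r \<partial>distr (lborel :: 'a measure) borel norm)"
    by (simp add: nn_integral_distr)
  then show ?thesis
    unfolding distr_norm_lborel by (simp add: nn_integral_density ac_simps)
qed

lemma nn_integral_norm_lborel_2:
  assumes [measurable]: "f \<in> borel_measurable borel"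
  shows "(\<integral>\<^sup>+ x. f (norm x) \<partial>(lborel :: (real^2) measure)) =
    ennreal (2 * pi) * (\<integral>\<^sup>+ r\<in>{0..}. ennreal r * f r \<partial>lborel)"
proof -
  have "(\<integral>\<^sup>+ x. f (norm x) \<partial>(lborel :: (real^2) measure)) =
      (\<integral>\<^sup>+ r. ennreal (2 * pi) * (ennreal r * f r * indicator {0..} r) \<partial>lborel)"
    by (subst nn_integral_norm_lborel)
      (auto intro!: nn_integral_cong simp: ennreal_mult' unit_ball_vol_2 ac_simps split: split_indicator)
  then show ?thesis
    by (simp add: nn_integral_cmult)
qed

text \<open>\<open>F\<close> is known to be measurable on \<open>{0..}\<close> only, which is where
  the norm takes its values.\<close>

lemma borel_measurable_norm_restrict:
  fixes F :: "real \<Rightarrow> real"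
  assumes "F \<in> borel_measurable (restrict_space borel {0..})"
  shows "(\<lambda>x::'b::euclidean_space. F (norm x)) \<in> borel_measurable borel"
  by (rule measurable_compose[OF _ assms]) (auto intro!: measurable_restrict_space2)

text \<open>A density with finite values against a \<sigma>-finite measure is again
  \<sigma>-finite.\<close>

lemma sigma_finite_radial_intensity:
  fixes F :: "real \<Rightarrow> real"
  assumes "F \<in> borel_measurable (restrict_space borel {0..})"
  shows "sigma_finite_measure (radial_intensity lam F :: 'b::euclidean_space measure)"
  unfolding radial_intensity_def
  by (subst sigma_finite_measure.sigma_finite_iff_density_finite[OF lborel.sigma_finite_measure_axioms])
    (auto intro!: borel_measurable_norm_restrict[OF assms] borel_measurable_times
      measurable_compose[OF _ measurable_ennreal])

lemma emeasure_radial_intensity_UNIV: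
  assumes F: "F \<in> borel_measurable (restrict_space borel {0..})" and "0 \<le> lam"
  shows "emeasure (radial_intensity lam F :: (real^2) measure) UNIV =
    ennreal (2 * pi * lam) * (\<integral>\<^sup>+ r\<in>{0..}. ennreal (r * F r) \<partial>lborel)"
proof -
  \<comment> \<open>Cutting off at 0 yields a function that is Borel on the whole line, as the polar
    formula requires, and changes nothing at the values of a norm.\<close>
  let ?f = "\<lambda>r. ennreal (lam * F r) * indicator {0..} r"
  have "(\<lambda>r::real. r) \<in> borel_measurable (restrict_space borel {0..})"
    by (rule measurable_restrict_space1) simp
  note [measurable] = F this
  have F': "(\<lambda>r. ennreal (lam * F r)) \<in> borel_measurable (restrict_space borel {0..})"
    by measurable
  then have f[measurable]: "?f \<in> borel_measurable borel"
    by (subst (asm) borel_measurable_restrict_space_iff_ennreal) auto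
  have "(\<lambda>r. ennreal (r * F r)) \<in> borel_measurable (restrict_space borel {0..})"
    by measurable
  then have m[measurable]: "(\<lambda>r. ennreal (r * F r) * indicator {0..} r) \<in> borel_measurable borel"
    by (subst (asm) borel_measurable_restrict_space_iff_ennreal) auto
  have [measurable]: "(\<lambda>x::real^2. F (norm x)) \<in> borel_measurable borel"
    by (rule borel_measurable_norm_restrict[OF F])
  have "emeasure (radial_intensity lam F :: (real^2) measure) UNIV =
      (\<integral>\<^sup>+ x. ?f (norm x) \<partial>(lborel :: (real^2) measure))"
    unfolding radial_intensity_def by (subst emeasure_density) auto
  also have "\<dots> = ennreal (2 * pi) * (\<integral>\<^sup>+ r\<in>{0..}. ennreal r * ?f r \<partial>lborel)"
    by (rule nn_integral_norm_lborel_2) (rule f)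
  also have "(\<integral>\<^sup>+ r\<in>{0..}. ennreal r * ?f r \<partial>lborel) =
      (\<integral>\<^sup>+ r. ennreal lam * (ennreal (r * F r) * indicator {0..} r) \<partial>lborel)"
    using \<open>0 \<le> lam\<close>
    by (intro nn_integral_cong) (auto simp: ennreal_mult' ac_simps split: split_indicator)
  also have "\<dots> = ennreal lam * (\<integral>\<^sup>+ r\<in>{0..}. ennreal (r * F r) \<partial>lborel)"
    by (rule nn_integral_cmult) simp
  finally show ?thesis
    using \<open>0 \<le> lam\<close> by (simp add: ennreal_mult' ac_simps)
qed

section \<open>Divergence and convergence of power-law tails\<close>

text \<open>The antiderivative is \<open>ln\<close>, so the interval from \<open>R\<close> to
  \<open>R * exp n\<close> contributes exactly \<open>n\<close>, for every \<open>n\<close>.\<close>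

lemma nn_integral_inverse_at_top_eq_top:
  fixes R :: real
  assumes "0 < R"
  shows "(\<integral>\<^sup>+ r\<in>{R..}. ennreal (1 / r) \<partial>lborel) = \<infinity>"
proof -
  have bound: "ennreal (real n) \<le> (\<integral>\<^sup>+ r\<in>{R..}. ennreal (1 / r) \<partial>lborel)" for n
  proof -
    have le: "R \<le> R * exp (real n)"
      using assms by simp
    have "(\<integral>\<^sup>+ r. ennreal (1 / r) * indicator {R..R * exp (real n)} r \<partial>lborel) =
        ennreal (ln (R * exp (real n)) - ln R)"
      using assms le
      by (intro nn_integral_FTC_Icc)
        (auto intro!: has_field_derivative_at_within DERIV_ln_divide)
    also have "ln (R * exp (real n)) - ln R = real n"
      using assms by (simp add: ln_mult)
    finally have "ennreal (real n) =
        (\<integral>\<^sup>+ r. ennreal (1 / r) * indicator {R..R * exp (real n)} r \<partial>lborel)"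
      by simp
    also have "\<dots> \<le> (\<integral>\<^sup>+ r\<in>{R..}. ennreal (1 / r) \<partial>lborel)"
      by (intro nn_integral_mono) (auto split: split_indicator)
    finally show ?thesis .
  qed
  have "(SUP n. of_nat n :: ennreal) \<le> (\<integral>\<^sup>+ r\<in>{R..}. ennreal (1 / r) \<partial>lborel)"
    using bound by (intro SUP_least) (simp add: ennreal_of_nat_eq_real_of_nat)
  then show ?thesis
    by (simp add: ennreal_SUP_of_nat_eq_top top_unique)
qed

lemma power_law_decay_bounds:
  assumes "power_law_decay F \<nu>"
  obtains L R where "0 < L" and "1 \<le> R"
    and "\<And>r. R \<le> r \<Longrightarrow> L * r powr (- \<nu>) \<le> F r" and "\<And>r. R \<le> r \<Longrightarrow> F r \<le> 4 * L * r powr (- \<nu>)"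
proof -
  obtain L where L: "0 < L" "((\<lambda>r. r powr \<nu> * F r) \<longlongrightarrow> L) at_top"
    using assms by (auto simp: power_law_decay_def)
  have "\<forall>\<^sub>F r in at_top. L / 2 < r powr \<nu> * F r" "\<forall>\<^sub>F r in at_top. r powr \<nu> * F r < 2 * L"
    by (rule order_tendstoD[OF L(2)], use L(1) in simp)+
  then have "\<forall>\<^sub>F r in at_top. L / 2 < r powr \<nu> * F r \<and> r powr \<nu> * F r < 2 * L"
    by (rule eventually_conj)
  then obtain R where R: "\<And>r. R \<le> r \<Longrightarrow> L / 2 < r powr \<nu> * F r \<and> r powr \<nu> * F r < 2 * L"
    by (auto simp: eventually_at_top_linorder)
  show thesis
  \<comment> \<open>The constant handed out is half the limit, so the bounds \<open>L / 2\<close>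
    and \<open>2 * L\<close> become once and four times that constant. The maximum with 1 keeps
    \<open>r\<close> positive, for the division by \<open>r powr \<nu>\<close>.\<close>
  proof (rule that[of "L / 2" "max 1 R"])
    fix r assume "max 1 R \<le> r"
    then have r: "0 < r powr \<nu>" "L / 2 < r powr \<nu> * F r \<and> r powr \<nu> * F r < 2 * L"
      using R by auto
    show "L / 2 * r powr (- \<nu>) \<le> F r" "F r \<le> 4 * (L / 2) * r powr (- \<nu>)"
      using r by (auto simp: powr_minus field_simps)
  qed (use L in auto)
qed

text \<open>For \<open>r\<close> at least 1 and \<nu> at most 2, \<open>r powr (- \<nu>)\<close>
  dominates \<open>r powr (- 2)\<close>. Hence \<open>r * F r\<close> is at least
  \<open>L / r\<close> far out.\<close>

lemma nn_integral_power_law_eq_top: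
  assumes "power_law_decay F \<nu>" and "\<nu> \<le> 2"
  shows "(\<integral>\<^sup>+ r\<in>{0..}. ennreal (r * F r) \<partial>lborel) = \<infinity>"
proof -
  obtain L R where L: "0 < L" and R: "1 \<le> R" and F: "\<And>r. R \<le> r \<Longrightarrow> L * r powr (- \<nu>) \<le> F r"
    using power_law_decay_bounds[OF assms(1)] by metis
  have le: "L * (1 / r) \<le> r * F r" if "R \<le> r" for r
  proof -
    have "L * r powr (- 2) \<le> L * r powr (- \<nu>)"
      using that R L \<open>\<nu> \<le> 2\<close> by (intro mult_left_mono powr_mono) auto
    with F[OF that] have "r * (L * r powr (- 2)) \<le> r * F r"
      using that R by (intro mult_left_mono) auto
    moreover have "r * (L * r powr (- 2)) = L * (1 / r)"
      using that R by (simp add: powr_minus power2_eq_square field_simps)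
    ultimately show ?thesis
      by simp
  qed
  have "\<infinity> = ennreal L * (\<integral>\<^sup>+ r\<in>{R..}. ennreal (1 / r) \<partial>lborel)"
    using L R nn_integral_inverse_at_top_eq_top[of R] by (simp add: ennreal_mult_top)
  also have "\<dots> = (\<integral>\<^sup>+ r. ennreal L * (ennreal (1 / r) * indicator {R..} r) \<partial>lborel)"
    by (rule nn_integral_cmult[symmetric]) measurable
  also have "\<dots> \<le> (\<integral>\<^sup>+ r\<in>{0..}. ennreal (r * F r) \<partial>lborel)"
    using L R le by (intro nn_integral_mono)
      (auto simp flip: ennreal_mult' split: split_indicator intro!: ennreal_leI)
  finally show ?thesis
    by (simp add: top_unique)
qed

text \<open>On a disc of radius \<open>R\<close> the integrand is bounded by \<open>lam / c\<close>.
  Outside it is at most a multiple of \<open>norm x powr (- 2 - \<nu>)\<close>, which is integrable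
  in the plane since \<nu> is positive.\<close>

lemma nn_integral_path_loss_finite:
  fixes y :: "real^2"
  assumes "0 < c" and "0 < lam" and "0 < \<nu>"
    and F: "F \<in> borel_measurable (restrict_space borel {0..})"
    and F01: "\<And>r. r \<ge> 0 \<Longrightarrow> 0 \<le> F r \<and> F r \<le> 1"
    and decay: "power_law_decay F \<nu>"
  shows "(\<integral>\<^sup>+ x. ennreal (path_loss c 2 (norm (x - y))) \<partial>radial_intensity lam F) < \<infinity>"
proof -
  obtain L R0 where L: "0 < L" and "1 \<le> R0" and FR: "\<And>r. R0 \<le> r \<Longrightarrow> F r \<le> 4 * L * r powr (- \<nu>)"
    using power_law_decay_bounds[OF decay] by metis
  \<comment> \<open>The second bound ensures \<open>norm (x - y) \<ge> norm x / 2\<close> outside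
    the disc, so that moving the receiver away from the origin costs only a constant.\<close>
  define R where "R = max R0 (2 * norm y)"
  have R: "1 \<le> R" "R0 \<le> R" "2 * norm y \<le> R"
    using \<open>1 \<le> R0\<close> by (auto simp: R_def)
  note [measurable] = borel_measurable_norm_restrict[OF F, where 'b = "real^2"]
  have [measurable]: "cball (0::real^2) R \<in> sets borel"
    by (intro borel_closed closed_cball)
  have [measurable]: "path_loss c 2 \<in> borel_measurable borel"
    unfolding path_loss_def[abs_def] by measurable
  \<comment> \<open>One factor 4 comes from the bound on \<open>F\<close>, the other from squaring
    \<open>norm x / 2\<close>.\<close>
  define B where "B = 16 * lam * L"
  let ?far = "\<lambda>r. ennreal B * (ennreal (r powr (- 2 - \<nu>)) * indicator {R..} r)"
  have near: "lam * F (norm x) * path_loss c 2 (norm (x - y)) \<le> lam / c" for x :: "real^2"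
  proof -
    have "path_loss c 2 (norm (x - y)) \<le> 1 / c"
      using \<open>0 < c\<close> by (auto simp: path_loss_def intro!: divide_left_mono mult_pos_pos add_pos_nonneg)
    then have "lam * F (norm x) * path_loss c 2 (norm (x - y)) \<le> lam * 1 * (1 / c)"
      using assms by (intro mult_mono) (auto simp: path_loss_def)
    then show ?thesis
      by simp
  qed
  have far: "lam * F (norm x) * path_loss c 2 (norm (x - y)) \<le> B * norm x powr (- 2 - \<nu>)"
    if x: "R \<le> norm x" for x :: "real^2"
  proof -
    have pos: "0 < norm x"
      using x R by linarith
    have "norm x / 2 \<le> norm (x - y)"
      using norm_triangle_ineq2[of x y] x R by linarith
    then have "(norm x / 2)\<^sup>2 \<le> (norm (x - y))\<^sup>2"
      by (intro power_mono) auto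
    also have "\<dots> \<le> c + norm (x - y) powr 2"
      using \<open>0 < c\<close> by simp
    finally have "(norm x / 2)\<^sup>2 \<le> c + norm (x - y) powr 2" .
    then have "path_loss c 2 (norm (x - y)) \<le> 1 / (norm x / 2)\<^sup>2"
      unfolding path_loss_def using pos \<open>0 < c\<close>
      by (intro divide_left_mono mult_pos_pos add_pos_nonneg) auto
    moreover have "F (norm x) \<le> 4 * L * norm x powr (- \<nu>)"
      using FR x R by auto
    ultimately have "lam * F (norm x) * path_loss c 2 (norm (x - y)) \<le>
        lam * (4 * L * norm x powr (- \<nu>)) * (1 / (norm x / 2)\<^sup>2)"
      using assms L by (intro mult_mono) (auto simp: path_loss_def)
    also have "\<dots> = B * (norm x powr (- \<nu>) * norm x powr (- 2))"
      using pos by (simp add: B_def powr_minus field_simps)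
    also have "norm x powr (- \<nu>) * norm x powr (- 2) = norm x powr (- 2 - \<nu>)"
      using powr_add[of "norm x" "- 2" "- \<nu>"] by (simp add: mult.commute)
    finally show ?thesis .
  qed
  have "(\<integral>\<^sup>+ x. ennreal (path_loss c 2 (norm (x - y))) \<partial>radial_intensity lam F) =
      (\<integral>\<^sup>+ x. ennreal (lam * F (norm x) * path_loss c 2 (norm (x - y))) \<partial>lborel)"
    unfolding radial_intensity_def using assms
    by (subst nn_integral_density) (auto simp: ennreal_mult' intro!: nn_integral_cong)
  also have "\<dots> \<le>
      (\<integral>\<^sup>+ x. ennreal (lam / c) * indicator (cball 0 R) x + ?far (norm x) \<partial>(lborel :: (real^2) measure))"
  proof (rule nn_integral_mono)
    fix x :: "real^2"
    show "ennreal (lam * F (norm x) * path_loss c 2 (norm (x - y))) \<le>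
        ennreal (lam / c) * indicator (cball 0 R) x + ?far (norm x)"
    proof (cases "R \<le> norm x")
      case True
      then have "ennreal (lam * F (norm x) * path_loss c 2 (norm (x - y))) \<le> ?far (norm x)"
        using far[OF True] L \<open>0 < lam\<close> by (simp add: B_def ennreal_leI flip: ennreal_mult')
      then show ?thesis
        by (rule order_trans) simp
    next
      case False
      then show ?thesis
        using near[of x] by (simp add: ennreal_leI)
    qed
  qed
  also have "\<dots> = ennreal (lam / c) * emeasure lborel (cball (0::real^2) R) +
      (\<integral>\<^sup>+ x. ?far (norm x) \<partial>(lborel :: (real^2) measure))"
    by (subst nn_integral_add) (auto simp: nn_integral_cmult)
  also have "\<dots> < \<infinity>"
  proof -
    \<comment> \<open>This antiderivative of \<open>r powr (- 1 - \<nu>)\<close> tends to 0 because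
      \<nu> is positive.\<close>
    have lim: "((\<lambda>r. - (r powr (- \<nu>) / \<nu>)) \<longlongrightarrow> - (0 / \<nu>)) at_top"
      using \<open>0 < \<nu>\<close> by (intro tendsto_intros tendsto_neg_powr filterlim_ident) auto
    have "(\<integral>\<^sup>+ x. ?far (norm x) \<partial>(lborel :: (real^2) measure)) =
        ennreal (2 * pi) * (\<integral>\<^sup>+ r\<in>{0..}. ennreal r * ?far r \<partial>lborel)"
      by (rule nn_integral_norm_lborel_2) measurable
    also have "(\<integral>\<^sup>+ r\<in>{0..}. ennreal r * ?far r \<partial>lborel) =
        (\<integral>\<^sup>+ r. ennreal B * (ennreal (r powr (- 1 - \<nu>)) * indicator {R..} r) \<partial>lborel)"
    proof (rule nn_integral_cong)
      fix r :: real
      \<comment> \<open>The factor \<open>r\<close> of polar coordinates raises the exponent by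
        one.\<close>
      have "ennreal (r powr (- 2 - \<nu>)) * ennreal r = ennreal (r powr (- 1 - \<nu>))" if "R \<le> r"
      proof -
        have "r * r powr (- 2 - \<nu>) = r powr (1 + (- 2 - \<nu>))"
          using that R by (subst powr_add) simp
        then show ?thesis
          using that R by (simp add: mult.commute flip: ennreal_mult')
      qed
      then show "ennreal r * ?far r * indicator {0..} r =
          ennreal B * (ennreal (r powr (- 1 - \<nu>)) * indicator {R..} r)"
        using R by (auto simp: mult.commute mult.left_commute split: split_indicator)
    qed
    also have "\<dots> = ennreal B * (\<integral>\<^sup>+ r. ennreal (r powr (- 1 - \<nu>)) * indicator {R..} r \<partial>lborel)"
      by (rule nn_integral_cmult) measurable
    also have "(\<integral>\<^sup>+ r. ennreal (r powr (- 1 - \<nu>)) * indicator {R..} r \<partial>lborel) =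
        ennreal (- (0 / \<nu>) - - (R powr (- \<nu>) / \<nu>))"
    proof (rule nn_integral_FTC_atLeast[OF _ _ _ lim])
      fix r assume "R \<le> r"
      with R have "0 < r"
        by linarith
      then show "((\<lambda>r. - (r powr (- \<nu>) / \<nu>)) has_real_derivative r powr (- 1 - \<nu>)) (at r)"
        using \<open>0 < \<nu>\<close>
        by (auto intro!: derivative_eq_intros arg_cong[of _ _ "(powr) r"] simp: field_simps)
    qed auto
    finally show ?thesis
      by (simp add: ennreal_mult_less_top emeasure_cball R order.trans[OF zero_le_one R(1)] less_top)
  qed
  finally show ?thesis .
qed

theorem corollary2:
  fixes M :: "'w measure"
    and K :: "'w \<Rightarrow> enat" and X :: "nat \<Rightarrow> 'w \<Rightarrow> real^2" and g :: "nat \<Rightarrow> 'w \<Rightarrow> real"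
    and \<alpha> c lam \<nu> :: real and y0 :: "real^2" and F :: "real \<Rightarrow> real"
  assumes "\<alpha> = 2" and "c > 0" and "lam > 0" and "0 < \<nu>" and "\<nu> \<le> 2"
    and "F \<in> borel_measurable (restrict_space borel {0..})"
    and "\<And>r. r \<ge> 0 \<Longrightarrow> 0 \<le> F r \<and> F r \<le> 1"
    and "power_law_decay F \<nu>"
    and "prob_space M"
    and "poisson_process M (radial_intensity lam F) K X"
    and "iid_fading_marks M K X g"
  shows "(\<integral>\<^sup>+ \<omega>. point_count K X UNIV \<omega> \<partial>M)
           = ennreal (2 * pi * lam) * (\<integral>\<^sup>+ r\<in>{0..}. ennreal (r * F r) \<partial>lborel)
       \<and> ennreal (2 * pi * lam) * (\<integral>\<^sup>+ r\<in>{0..}. ennreal (r * F r) \<partial>lborel) = \<infinity>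
       \<and> (\<integral>\<^sup>+ \<omega>. interference (path_loss c \<alpha>) K X g y0 \<omega> \<partial>M) < \<infinity>"
proof (intro conjI)
  let ?\<Lambda> = "radial_intensity lam F :: (real^2) measure"
  let ?I = "\<integral>\<^sup>+ r\<in>{0..}. ennreal (r * F r) \<partial>lborel"
  have \<Lambda>: "sigma_finite_measure ?\<Lambda>" "sets ?\<Lambda> = sets borel"
    using sigma_finite_radial_intensity[OF assms(6)] by (auto simp: radial_intensity_def)
  \<comment> \<open>The whole plane turns out to have infinite intensity, so the extension of the
    mean count beyond sets of finite intensity is essential here.\<close>
  show "(\<integral>\<^sup>+ \<omega>. point_count K X UNIV \<omega> \<partial>M) = ennreal (2 * pi * lam) * ?I"
    using nn_integral_point_count[OF assms(9,10) \<Lambda>, of UNIV]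
      emeasure_radial_intensity_UNIV[OF assms(6)] \<open>lam > 0\<close> by simp
  show "ennreal (2 * pi * lam) * ?I = \<infinity>"
    using nn_integral_power_law_eq_top[OF assms(8,5)] \<open>lam > 0\<close> by (simp add: ennreal_mult_top)
  have "path_loss c 2 \<in> borel_measurable borel"
    unfolding path_loss_def[abs_def] by measurable
  then have "(\<integral>\<^sup>+ \<omega>. interference (path_loss c 2) K X g y0 \<omega> \<partial>M) =
      (\<integral>\<^sup>+ x. ennreal (path_loss c 2 (norm (x - y0))) \<partial>?\<Lambda>)"
    using \<open>c > 0\<close>
    by (intro nn_integral_interference[OF assms(9,10) \<Lambda> assms(11)]) (auto simp: path_loss_def)
  also have "\<dots> < \<infinity>"
    by (rule nn_integral_path_loss_finite[OF assms(2-4,6-8)])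
  finally show "(\<integral>\<^sup>+ \<omega>. interference (path_loss c \<alpha>) K X g y0 \<omega> \<partial>M) < \<infinity>"
    by (simp add: \<open>\<alpha> = 2\<close>)
qed

end
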